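(* Let $\alpha$ be a rational angle. Then: (i) $\cos\alpha$ is an algebraic number; moreover, $2\cos\alpha$ is an algebraic integer. (ii) All the conjugates of $2\cos\alpha$ (that is, all complex roots of the minimal polynomial of $2\cos\alpha$ over $\mathbb{Q}$) are of absolute value $\leq 2$.
   Context: A rational angle is an angle of the form $\alpha = \frac{m}{n}\cdot 360^\circ$ with $m,n\in\mathbb{Z}$, $n\neq 0$; equivalently, in radians, $\alpha = 2\pi \frac{m}{n}$. *)

theory Defs
  imports Complex_Main "HOL-Computational_Algebra.Computational_Algebra"
begin

text \<open>Angles are in radians.\<close>

definition rational_angle :: "real \<Rightarrow> bool" where
  "rational_angle \<alpha> \<longleftrightarrow>
     (\<exists>m n :: int. n \<noteq> 0 \<and> \<alpha> = 2 * pi * (real_of_int m / real_of_int n))"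

definition is_min_poly :: "rat poly \<Rightarrow> 'a :: field_char_0 \<Rightarrow> bool" where
  "is_min_poly p x \<longleftrightarrow>
     lead_coeff p = 1 \<and> poly (map_poly of_rat p) x = 0 \<and>
     (\<forall>q. q \<noteq> 0 \<and> poly (map_poly of_rat q) x = 0 \<longrightarrow> degree p \<le> degree q)"

text \<open>Meaningful only for algebraic arguments: see \<open>min_poly_ex1\<close> below.\<close>

definition min_poly :: "'a :: field_char_0 \<Rightarrow> rat poly" where
  "min_poly x = (THE p. is_min_poly p x)"

definition conjugates :: "'a :: field_char_0 \<Rightarrow> complex set" where
  "conjugates x = {z. poly (map_poly of_rat (min_poly x)) z = 0}"

lemma poly_of_rat_diff:
  "poly (map_poly of_rat (p - q)) (x :: 'a :: field_char_0) =
     poly (map_poly of_rat p) x - poly (map_poly of_rat q) x"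
proof -
  have "map_poly of_rat (p - q) = (map_poly of_rat p - map_poly of_rat q :: 'a poly)"
    by (intro poly_eqI) (simp add: coeff_map_poly of_rat_diff)
  then show ?thesis by simp
qed

lemma poly_of_rat_smult:
  "poly (map_poly of_rat (smult c p)) (x :: 'a :: field_char_0) =
     of_rat c * poly (map_poly of_rat p) x"
proof -
  have "map_poly of_rat (smult c p) = (smult (of_rat c) (map_poly of_rat p) :: 'a poly)"
    by (intro poly_eqI) (simp add: coeff_map_poly of_rat_mult)
  then show ?thesis by simp
qed

lemma min_poly_ex1:
  fixes x :: "'a :: field_char_0"
  assumes "algebraic x"
  shows "\<exists>!p. is_min_poly p x"
proof (rule ex_ex1I)
  define R where "R = (\<lambda>q :: rat poly. q \<noteq> 0 \<and> poly (map_poly of_rat q) x = 0)"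
  from assms obtain p :: "'a poly"
    where p: "\<forall>i. coeff p i \<in> \<rat>" "p \<noteq> 0" "poly p x = 0"
    unfolding algebraic_altdef by blast
  then have "\<forall>i. \<exists>r. coeff p i = of_rat r"
    by (auto elim: Rats_cases)
  define g :: "'a \<Rightarrow> rat" where "g = inv of_rat"
  have g: "of_rat (g (coeff p i)) = coeff p i" for i
    unfolding g_def using \<open>\<forall>i. \<exists>r. coeff p i = of_rat r\<close>
    by (metis f_inv_into_f rangeI)
  have g0: "g 0 = 0"
    unfolding g_def by (rule inv_f_eq) (auto simp: inj_def)
  have eq: "map_poly of_rat (map_poly g p) = p"
    by (intro poly_eqI) (simp add: coeff_map_poly g g0)
  have "R (map_poly g p)"
    unfolding R_def using eq p by (auto simp del: map_poly_eq_0_iff)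
  then obtain q where q: "R q" "\<forall>r. R r \<longrightarrow> degree q \<le> degree r"
    using ex_has_least_nat[of R _ degree] by blast
  have "is_min_poly (smult (inverse (lead_coeff q)) q) x"
    using q unfolding is_min_poly_def R_def by (simp add: poly_of_rat_smult)
  then show "\<exists>p. is_min_poly p x" ..
next
  fix p q
  assume p: "is_min_poly p x" and q: "is_min_poly q x"
  have nz: "p \<noteq> 0" "q \<noteq> 0"
    using p q by (auto simp: is_min_poly_def)
  then have deg: "degree q = degree p"
    using p q unfolding is_min_poly_def by (meson order_antisym)
  show "p = q"
  proof (rule ccontr)
    assume "p \<noteq> q"
    then have d: "p - q \<noteq> 0" by simp
    have "poly (map_poly of_rat (p - q)) x = 0"
      using p q by (simp add: is_min_poly_def poly_of_rat_diff)
    then have "degree p \<le> degree (p - q)"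
      using p d unfolding is_min_poly_def by blast
    moreover have "degree (p - q) \<le> degree p"
      using degree_diff_le[of p "degree p" q] deg by simp
    ultimately have "coeff (p - q) (degree p) \<noteq> 0"
      using d by (metis leading_coeff_0_iff order_antisym)
    then show False
      using p q deg by (simp add: is_min_poly_def)
  qed
qed

lemma is_min_poly_min_poly: "algebraic x \<Longrightarrow> is_min_poly (min_poly x) x"
  unfolding min_poly_def by (rule theI') (rule min_poly_ex1)

end

theory Submission
  imports Defs
begin

text \<open>
  The functions \<open>w\<^sup>n + w\<^sup>-\<^sup>n\<close> are monic integer polynomials in \<open>w + 1/w\<close>, the Dickson
  polynomials \<open>D\<^sub>n\<close>. With \<open>w = cis \<alpha>\<close> this reads \<open>D\<^sub>n (2 cos \<alpha>) = 2 cos (n \<alpha>)\<close>, so for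
  \<open>\<alpha> = 2 \<pi> m / n\<close> the number \<open>2 cos \<alpha>\<close> is a root of the monic integer polynomial \<open>D\<^sub>n - 2\<close>,
  hence an algebraic integer.

  The same polynomial controls the conjugates, because it is divisible by the minimal polynomial:
  every conjugate \<open>z\<close> satisfies \<open>D\<^sub>n z = 2\<close>. Any complex \<open>z\<close> can be written as \<open>w + 1/w\<close>,
  and then \<open>w\<^sup>n + w\<^sup>-\<^sup>n = 2\<close>, that is \<open>(w\<^sup>n - 1)\<^sup>2 = 0\<close>. So \<open>w\<close> is a root of unity, it has
  absolute value 1, and the triangle inequality gives \<open>\<bar>z\<bar> \<le> 2\<close>.
\<close>

text \<open>
  The Dickson polynomials with parameter 1, equal to \<open>2 T\<^sub>n (X/2)\<close> for the Chebyshev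
  polynomials \<open>T\<^sub>n\<close>; the rescaling is what makes them monic. They are polymorphic in the
  coefficient ring so that one family serves the rational, real and complex arguments.
\<close>

fun dickson :: "nat \<Rightarrow> 'a :: comm_ring_1 poly" where
  "dickson 0 = [:2:]"
| "dickson (Suc 0) = [:0, 1:]"
| "dickson (Suc (Suc n)) = pCons 0 (dickson (Suc n)) - dickson n"

lemma degree_dickson_le: "degree (dickson n :: 'a :: comm_ring_1 poly) \<le> n"
proof (induction n rule: dickson.induct)
  case (3 n)
  have "degree (pCons 0 (dickson (Suc n)) :: 'a poly) \<le> Suc (Suc n)"
    using 3(1) degree_pCons_le[of 0 "dickson (Suc n) :: 'a poly"] by linarith
  with 3(2) show ?case
    by (auto intro!: degree_diff_le)
qed auto

lemma coeff_dickson_top: "coeff (dickson (Suc n) :: 'a :: comm_ring_1 poly) (Suc n) = 1"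
proof (induction n)
  case (Suc n)
  have "coeff (dickson n :: 'a poly) (Suc (Suc n)) = 0"
    using degree_dickson_le[of n, where ?'a = 'a] by (intro coeff_eq_0) auto
  with Suc show ?case by simp
qed simp

lemma coeff_dickson_Ints: "coeff (dickson n :: 'a :: comm_ring_1 poly) i \<in> \<int>"
  by (induction n arbitrary: i rule: dickson.induct)
     (auto simp: coeff_pCons split: nat.splits)

text \<open>
  For \<open>n = 0\<close> the difference is the zero polynomial, since \<open>D\<^sub>0 = 2\<close>.
\<close>

lemma monic_dickson_minus_2:
  assumes "n > 0"
  shows "lead_coeff (dickson n - [:2:] :: 'a :: comm_ring_1 poly) = 1"
proof -
  obtain k where n: "n = Suc k"
    using assms by (cases n) auto
  have top: "coeff (dickson n - [:2:] :: 'a poly) n = 1"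
    using coeff_dickson_top[of k] by (simp add: n)
  moreover have "degree (dickson n - [:2:] :: 'a poly) \<le> n"
    using degree_dickson_le[of n] by (intro degree_diff_le) auto
  moreover have "n \<le> degree (dickson n - [:2:] :: 'a poly)"
    using top by (intro le_degree) auto
  ultimately show ?thesis by simp
qed

text \<open>
  The recursion of \<open>D\<^sub>n\<close> is that of the power sums of the two roots \<open>w, v\<close> of
  \<open>T\<^sup>2 - z T + 1\<close>. Stating it with \<open>w * v = 1\<close> avoids division.
\<close>

lemma poly_dickson:
  assumes "w * v = (1 :: 'a :: comm_ring_1)"
  shows "poly (dickson n) (w + v) = w ^ n + v ^ n"
proof (induction n rule: dickson.induct)
  case (3 n)
  have "(w + v) * (w ^ Suc n + v ^ Suc n) =
          w ^ Suc (Suc n) + v ^ Suc (Suc n) + w * v * (w ^ n + v ^ n)"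
    by (simp add: algebra_simps)
  with 3 show ?case
    by (simp add: assms)
qed auto

text \<open>
  The instance \<open>w, v = cis (\<plusminus>x)\<close> of the preceding lemma, kept over the reals: there the
  recursion is the sum of the addition formulas for \<open>cos ((n + 1) x \<plusminus> x)\<close>.
\<close>

lemma poly_dickson_cos: "poly (dickson n) (2 * cos x) = 2 * cos (real n * x)"
proof (induction n rule: dickson.induct)
  case (3 n)
  have "cos (real (Suc (Suc n)) * x) + cos (real n * x) =
          2 * cos (real (Suc n) * x) * cos x"
    using cos_add[of "real (Suc n) * x" x] cos_diff[of "real (Suc n) * x" x]
    by (simp add: algebra_simps)
  with 3 show ?case
    by (simp add: algebra_simps)
qed auto

text \<open>
  The witnesses are the roots of \<open>T\<^sup>2 - z T + 1\<close> given by the quadratic formula.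
\<close>

lemma ex_add_inverse_eq:
  fixes z :: complex
  obtains w v where "w * v = 1" "z = w + v"
proof
  define s where "s = csqrt (z\<^sup>2 - 4)"
  have "s\<^sup>2 = z\<^sup>2 - 4"
    by (simp add: s_def)
  then show "((z + s) / 2) * ((z - s) / 2) = 1"
    by (simp add: field_simps power2_eq_square)
  show "z = (z + s) / 2 + (z - s) / 2"
    by (simp add: field_simps)
qed

lemma norm_le_2_if_dickson_eq_2:
  fixes z :: complex
  assumes "n > 0" "poly (dickson n) z = 2"
  shows "cmod z \<le> 2"
proof -
  obtain w v where wv: "w * v = 1" and z: "z = w + v"
    by (rule ex_add_inverse_eq)
  have sum: "w ^ n + v ^ n = 2"
    using assms(2) poly_dickson[OF wv] by (simp add: z)
  have prod: "w ^ n * v ^ n = 1"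
    using wv by (simp flip: power_mult_distrib)
  have "(w ^ n - 1)\<^sup>2 = w ^ n * (w ^ n + v ^ n) - w ^ n * v ^ n - 2 * w ^ n + 1"
    by (simp add: algebra_simps power2_eq_square)
  also have "\<dots> = 0"
    by (simp only: sum prod) simp
  finally have "w ^ n = 1" by simp
  with sum have "v ^ n = 1" by simp
  have unit: "cmod u = 1" if "u ^ n = 1" for u
    using that assms(1) power_eq_imp_eq_base[of "cmod u" n 1] by (simp flip: norm_power)
  show ?thesis
    using norm_triangle_ineq[of w v] unit[OF \<open>w ^ n = 1\<close>] unit[OF \<open>v ^ n = 1\<close>]
    by (simp add: z)
qed

lemma poly_of_rat_add:
  "poly (map_poly of_rat (p + q)) (x :: 'a :: field_char_0) =
     poly (map_poly of_rat p) x + poly (map_poly of_rat q) x"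
proof -
  have "map_poly of_rat (p + q) = (map_poly of_rat p + map_poly of_rat q :: 'a poly)"
    by (intro poly_eqI) (simp add: coeff_map_poly of_rat_add)
  then show ?thesis by simp
qed

lemma poly_of_rat_mult:
  "poly (map_poly of_rat (p * q)) (x :: 'a :: field_char_0) =
     poly (map_poly of_rat p) x * poly (map_poly of_rat q) x"
  by (induction p)
     (simp_all add: map_poly_pCons poly_of_rat_add poly_of_rat_smult algebra_simps)

lemma poly_of_rat_dickson:
  "poly (map_poly of_rat (dickson n)) (x :: 'a :: field_char_0) = poly (dickson n) x"
  by (induction n rule: dickson.induct) (simp_all add: map_poly_pCons poly_of_rat_diff)

text \<open>
  The remainder of \<open>q\<close> modulo \<open>p\<close> also vanishes at \<open>x\<close> and has smaller degree, so minimality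
  of the degree of \<open>p\<close> forces it to be 0.
\<close>

lemma is_min_poly_dvd:
  assumes "is_min_poly p (x :: 'a :: field_char_0)" "poly (map_poly of_rat q) x = 0"
  shows "p dvd q"
proof -
  have nz: "p \<noteq> 0" and root: "poly (map_poly of_rat p) x = 0"
    using assms(1) by (auto simp: is_min_poly_def)
  have "poly (map_poly of_rat (q mod p)) x = 0"
    unfolding minus_div_mult_eq_mod[symmetric]
    using assms(2) root by (simp only: poly_of_rat_diff poly_of_rat_mult) simp
  then have "q mod p = 0"
    using assms(1) degree_mod_less'[OF nz, of q]
    unfolding is_min_poly_def by (meson not_less)
  then show ?thesis by auto
qed

lemma conjugates_root:
  assumes "algebraic (x :: 'a :: field_char_0)" "poly (map_poly of_rat q) x = 0"
    and "z \<in> conjugates x"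
  shows "poly (map_poly of_rat q) z = 0"
proof -
  obtain r where "q = min_poly x * r"
    using is_min_poly_dvd[OF is_min_poly_min_poly[OF assms(1)] assms(2)] by (elim dvdE)
  then show ?thesis
    using assms(3) by (simp add: conjugates_def poly_of_rat_mult)
qed

lemma algebraic_if_algebraic_double:
  assumes "algebraic (2 * x :: 'a :: field_char_0)"
  shows "algebraic x"
proof -
  obtain p :: "'a poly" where p: "\<And>i. coeff p i \<in> \<int>" "p \<noteq> 0" "poly p (2 * x) = 0"
    using assms by (elim algebraicE) blast
  show ?thesis
  proof (rule algebraicI)
    show "coeff (pcompose p [:0, 2:]) i \<in> \<int>" for i
      using p(1) by (simp add: coeff_pcompose_linear)
    show "pcompose p [:0, 2:] \<noteq> 0"
      using p(2) by (simp add: pcompose_eq_0_iff)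
    show "poly (pcompose p [:0, 2:]) x = 0"
      using p(3) by (simp add: poly_pcompose mult.commute)
  qed
qed

text \<open>
  The denominator of a rational angle may be negative; its absolute value serves as the index,
  the sign being absorbed into the multiple of \<open>2 \<pi>\<close>.
\<close>

lemma rational_angle_dickson:
  assumes "rational_angle \<alpha>"
  obtains n where "n > 0" "poly (dickson n) (2 * cos \<alpha>) = 2"
proof -
  obtain m k :: int where k: "k \<noteq> 0" and \<alpha>: "\<alpha> = 2 * pi * (real_of_int m / real_of_int k)"
    using assms unfolding rational_angle_def by blast
  have "real (nat \<bar>k\<bar>) * \<alpha> = 2 * pi * real_of_int (sgn k * m)"
    using k by (simp add: \<alpha> abs_if sgn_if)
  then have "cos (real (nat \<bar>k\<bar>) * \<alpha>) = 1"
    by (metis cos_int_2pin)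
  then show ?thesis
    using k by (intro that[of "nat \<bar>k\<bar>"]) (auto simp: poly_dickson_cos)
qed

theorem mainTheorem2:
  fixes \<alpha> :: real
  assumes "rational_angle \<alpha>"
  shows "algebraic (cos \<alpha>) \<and> algebraic_int (2 * cos \<alpha>) \<and>
         (\<forall>z \<in> conjugates (2 * cos \<alpha>). cmod z \<le> 2)"
proof -
  obtain n where n: "n > 0" and root: "poly (dickson n) (2 * cos \<alpha>) = 2"
    using assms by (rule rational_angle_dickson)
  have int: "algebraic_int (2 * cos \<alpha>)"
  proof (rule algebraic_int.intros)
    show "lead_coeff (dickson n - [:2:] :: real poly) = 1"
      using n by (rule monic_dickson_minus_2)
    show "\<forall>i. coeff (dickson n - [:2:] :: real poly) i \<in> \<int>"
      by (auto simp: coeff_dickson_Ints coeff_pCons split: nat.splits)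
    show "poly (dickson n - [:2:]) (2 * cos \<alpha>) = 0"
      using root by simp
  qed
  then have alg: "algebraic (2 * cos \<alpha>)"
    by (rule algebraic_int_imp_algebraic)
  have "cmod z \<le> 2" if "z \<in> conjugates (2 * cos \<alpha>)" for z
  proof -
    have "poly (map_poly of_rat (dickson n - [:2:])) (2 * cos \<alpha>) = 0"
      using root by (simp add: poly_of_rat_diff poly_of_rat_dickson map_poly_pCons)
    then have "poly (map_poly of_rat (dickson n - [:2:])) z = 0"
      using conjugates_root[OF alg _ that] by blast
    then have "poly (dickson n) z = 2"
      by (simp add: poly_of_rat_diff poly_of_rat_dickson map_poly_pCons)
    with n show ?thesis
      by (rule norm_le_2_if_dickson_eq_2)
  qed
  with int algebraic_if_algebraic_double[OF alg] show ?thesis by blast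
qed

end
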